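(* Let $f:A\to B$ and $g:A\to C$ be ring homomorphisms, and let $J$ be an ideal of $B$ and $J'$ an ideal of $C$ such that $f^{-1}(J)=g^{-1}(J')$. Then $A\bowtie^{f,g}(J,J')$ is Noetherian if and only if both $f(A)+J$ and $g(A)+J'$ are Noetherian.
   Context: All rings are commutative with unity, and ring homomorphisms are unital. The bi-amalgamation of $A$ with $(B,C)$ along $(J,J')$ with respect to $(f,g)$ is the subring of $B\times C$ $$A\bowtie^{f,g}(J,J'):=\{(f(a)+j,\,g(a)+j')\mid a\in A,\ (j,j')\in J\times J'\}.$$ Here $f(A)+J=\{f(a)+j\mid a\in A, j\in J\}$ is a subring of $B$ and $g(A)+J'$ is a subring of $C$ (defined analogously). *)

theory Defs
  imports "HOL-Algebra.Algebra"
begin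

definition bi_amalgamation ::
  "('a, 'm) ring_scheme \<Rightarrow> ('b, 'n) ring_scheme \<Rightarrow> ('c, 'k) ring_scheme \<Rightarrow>
   ('a \<Rightarrow> 'b) \<Rightarrow> ('a \<Rightarrow> 'c) \<Rightarrow> 'b set \<Rightarrow> 'c set \<Rightarrow> ('b \<times> 'c) ring"
  where "bi_amalgamation A B C f g J J' =
    (RDirProd B C)\<lparr>carrier :=
      {(f a \<oplus>\<^bsub>B\<^esub> j, g a \<oplus>\<^bsub>C\<^esub> j') | a j j'. a \<in> carrier A \<and> (j, j') \<in> J \<times> J'}\<rparr>"

definition sum_subring ::
  "('a, 'm) ring_scheme \<Rightarrow> ('b, 'n) ring_scheme \<Rightarrow> ('a \<Rightarrow> 'b) \<Rightarrow> 'b set \<Rightarrow> ('b, 'n) ring_scheme"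
  where "sum_subring A B f J =
    B\<lparr>carrier := {f a \<oplus>\<^bsub>B\<^esub> j | a j. a \<in> carrier A \<and> j \<in> J}\<rparr>"

end

theory Submission
  imports Defs
begin

text \<open>The two projections exhibit the bi-amalgamation as a subdirect product of \<open>f(A) + J\<close> and
  \<open>g(A) + J'\<close>. Quotients of Noetherian rings are Noetherian. Conversely, if \<open>p\<close> and \<open>q\<close> are
  surjective with \<open>ker p \<inter> ker q = 0\<close>, then among comparable ideals \<open>I\<close> is determined by the
  ideals \<open>p(I)\<close> and \<open>q(I \<inter> ker p)\<close>, so chains of ideals stabilise.\<close>

section \<open>Ideals and ascending chains under ring homomorphisms\<close>

lemma (in ring_hom_ring) ideal_image:
  assumes surj: "h ` carrier R = carrier S" and I: "ideal I R"
  shows "ideal (h ` I) S"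
proof -
  interpret I: ideal I R by fact
  show ?thesis
  proof (rule idealI)
    show "ring S" by (rule S.ring_axioms)
    show "subgroup (h ` I) (add_monoid S)"
      using img_is_add_subgroup[OF I.a_subgroup] .
  next
    fix a x assume "a \<in> h ` I" "x \<in> carrier S"
    \<comment> \<open>Surjectivity enters here: a multiplier from \<open>S\<close> lifts to
      \<open>R\<close>, where \<open>I\<close> absorbs it. The additive part holds for every
      homomorphism.\<close>
    then obtain b y where "b \<in> I" "a = h b" "y \<in> carrier R" "x = h y"
      using surj by (metis imageE)
    then have "x \<otimes>\<^bsub>S\<^esub> a = h (y \<otimes> b)" "a \<otimes>\<^bsub>S\<^esub> x = h (b \<otimes> y)"
      using I.Icarr by simp_all
    with \<open>b \<in> I\<close> \<open>y \<in> carrier R\<close> show "x \<otimes>\<^bsub>S\<^esub> a \<in> h ` I" "a \<otimes>\<^bsub>S\<^esub> x \<in> h ` I"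
      using I.I_l_closed I.I_r_closed by blast+
  qed
qed

text \<open>A monotone \<open>F\<close> turns a chain of ideals of \<open>L\<close> into a chain of
  ideals of the Noetherian ring \<open>R\<close>, and there the union is attained. Only the values
  of \<open>F\<close> are compared, so each application must recover information about the ideals of
  \<open>L\<close> from those values.\<close>

lemma (in noetherian_ring) chain_of_ideals_has_greatest:
  assumes chain: "subset.chain {I. ideal I L} C" and "C \<noteq> {}"
    and ideal: "\<And>I. ideal I L \<Longrightarrow> ideal (F I) R"
    and mono: "\<And>I K. I \<subseteq> K \<Longrightarrow> F I \<subseteq> F K"
  shows "\<exists>I \<in> C. \<forall>K \<in> C. F K \<subseteq> F I"
proof -
  have "subset.chain {I. ideal I R} (F ` C)"
    unfolding subset_chain_def
  proof (intro conjI ballI)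
    show "F ` C \<subseteq> {I. ideal I R}"
      using chain ideal unfolding subset_chain_def by auto
    fix U V assume "U \<in> F ` C" "V \<in> F ` C"
    then show "U \<subseteq> V \<or> V \<subseteq> U"
      using chain mono unfolding subset_chain_def by (metis imageE)
  qed
  then have "\<Union>(F ` C) \<in> F ` C"
    using \<open>C \<noteq> {}\<close> by (intro ideal_chain_is_trivial) simp_all
  then obtain I where "I \<in> C" "\<Union>(F ` C) = F I" by blast
  then show ?thesis by blast
qed

text \<open>Preimages turn a chain of ideals of \<open>S\<close> into one of ideals of
  \<open>R\<close>. By surjectivity an ideal of \<open>S\<close> is determined by its preimage, so
  the member with the largest preimage is itself the largest.\<close>

lemma (in ring_hom_ring) noetherian_image:
  assumes surj: "h ` carrier R = carrier S" and "noetherian_ring R"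
  shows "noetherian_ring S"
proof (rule S.trivial_ideal_chain_imp_noetherian)
  fix C assume C: "C \<noteq> {}" "subset.chain {I. ideal I S} C"
  interpret noetherian_ring R by fact
  obtain I where I: "I \<in> C" "\<forall>K \<in> C. {r \<in> carrier R. h r \<in> K} \<subseteq> {r \<in> carrier R. h r \<in> I}"
    using chain_of_ideals_has_greatest[OF C(2,1), of "\<lambda>K. {r \<in> carrier R. h r \<in> K}"]
      ideal_vimage by blast
  have "K \<subseteq> I" if "K \<in> C" for K
  proof
    fix x assume "x \<in> K"
    moreover have "ideal K S"
      using C(2) \<open>K \<in> C\<close> unfolding subset_chain_def by blast
    ultimately obtain r where "r \<in> carrier R" "x = h r"
      using surj ideal.Icarr by (metis imageE)
    then show "x \<in> I" using I(2) \<open>K \<in> C\<close> \<open>x \<in> K\<close> by blast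
  qed
  then have "\<Union>C = I" using I(1) by blast
  then show "\<Union>C \<in> C" using I(1) by simp
qed

lemma noetherian_subdirect_product:
  fixes R (structure)
  assumes p: "ring_hom_ring R S p" "p ` carrier R = carrier S"
    and q: "ring_hom_ring R T q" "q ` carrier R = carrier T"
    and trivial: "a_kernel R S p \<inter> a_kernel R T q = {\<zero>}"
    and S: "noetherian_ring S" and T: "noetherian_ring T"
  shows "noetherian_ring R"
proof -
  interpret ring R using p(1) by (rule ring_hom_ring.axioms)
  interpret p: ring_hom_ring R S p by fact
  interpret q: ring_hom_ring R T q by fact
  interpret S: noetherian_ring S by fact
  interpret T: noetherian_ring T by fact
  define N where "N = a_kernel R S p"
  have N: "ideal N R" unfolding N_def by (rule p.kernel_is_ideal)
  \<comment> \<open>An element \<open>x\<close> of \<open>K\<close> is corrected twice by elements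
    of \<open>I\<close>: subtracting \<open>y\<close> moves it into the kernel of \<open>p\<close>,
    and subtracting \<open>z\<close> then moves it into the kernel of \<open>q\<close>.\<close>
  have sub: "K \<subseteq> I"
    if I: "ideal I R" and K: "ideal K R" and "I \<subseteq> K"
      and pK: "p ` K \<subseteq> p ` I" and qK: "q ` (K \<inter> N) \<subseteq> q ` (I \<inter> N)" for I K
  proof
    interpret I: ideal I R by fact
    interpret K: ideal K R by fact
    fix x assume x: "x \<in> K"
    then obtain y where y: "y \<in> I" "p x = p y" using pK by blast
    have carr: "x \<in> carrier R" "y \<in> carrier R" using x y I.Icarr K.Icarr by auto
    have "x \<ominus> y \<in> K" using x y \<open>I \<subseteq> K\<close> K.a_closed K.a_inv_closed
      unfolding a_minus_def by blast
    moreover have "x \<ominus> y \<in> N"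
      using carr y(2) unfolding N_def a_kernel_def' a_minus_def by (simp add: p.S.r_neg)
    \<comment> \<open>Choosing \<open>z\<close> in \<open>N\<close>, and not merely in
      \<open>I\<close>, keeps the second difference in the kernel of \<open>p\<close>. It thus lies
      in both kernels and vanishes.\<close>
    ultimately obtain z where z: "z \<in> I" "z \<in> N" "q (x \<ominus> y) = q z" using qK by blast
    have zc: "z \<in> carrier R" using z I.Icarr by auto
    have "(x \<ominus> y) \<ominus> z \<in> N"
      using \<open>x \<ominus> y \<in> N\<close> z(2) carr zc unfolding N_def a_kernel_def' a_minus_def by simp
    moreover have "(x \<ominus> y) \<ominus> z \<in> a_kernel R T q"
      using carr zc z(3) unfolding a_kernel_def' a_minus_def by (simp add: q.S.r_neg)
    ultimately have "(x \<ominus> y) \<ominus> z = \<zero>" using trivial unfolding N_def by blast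
    then have "x \<ominus> y = z" using carr zc by simp
    then have "z \<oplus> y = x" using carr by (auto simp: a_minus_def a_assoc l_neg)
    then show "x \<in> I" using z y I.a_closed by blast
  qed
  show ?thesis
  proof (rule trivial_ideal_chain_imp_noetherian)
    fix C assume C: "C \<noteq> {}" "subset.chain {I. ideal I R} C"
    obtain I1 where I1: "I1 \<in> C" "\<forall>K \<in> C. p ` K \<subseteq> p ` I1"
      using S.chain_of_ideals_has_greatest[OF C(2,1), of "\<lambda>K. p ` K"] p.ideal_image[OF p(2)]
        image_mono by metis
    obtain I2 where I2: "I2 \<in> C" "\<forall>K \<in> C. q ` (K \<inter> N) \<subseteq> q ` (I2 \<inter> N)"
      using T.chain_of_ideals_has_greatest[OF C(2,1), of "\<lambda>K. q ` (K \<inter> N)"]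
        q.ideal_image[OF q(2) i_intersect[OF _ N]] by blast
    have total: "U \<subseteq> V \<or> V \<subseteq> U" if "U \<in> C" "V \<in> C" for U V
      using C(2) that unfolding subset_chain_def by blast
    \<comment> \<open>The larger of \<open>I1\<close> and \<open>I2\<close> maximises both images at
      once, since both are monotone in the ideal.\<close>
    obtain I where I: "I \<in> C" "I1 \<subseteq> I" "I2 \<subseteq> I"
      using total[OF I1(1) I2(1)] I1(1) I2(1) by blast
    have "K \<subseteq> I" if "K \<in> C" for K
    proof (rule ccontr)
      assume "\<not> K \<subseteq> I"
      \<comment> \<open>Comparability in the chain supplies the inclusion that \<open>sub\<close>
        requires.\<close>
      then have "I \<subseteq> K" using total[OF that I(1)] by blast
      moreover have "ideal I R" "ideal K R"
        using C(2) that I(1) unfolding subset_chain_def by blast+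
      moreover have "p ` K \<subseteq> p ` I"
        using bspec[OF I1(2) that] image_mono[OF I(2), of p] by (rule order_trans)
      moreover have "q ` (K \<inter> N) \<subseteq> q ` (I \<inter> N)"
        using bspec[OF I2(2) that] image_mono[OF Int_mono[OF I(3) order_refl[of N]], of q]
        by (rule order_trans)
      ultimately show False using sub \<open>\<not> K \<subseteq> I\<close> by blast
    qed
    then have "\<Union>C = I" using I(1) by blast
    then show "\<Union>C \<in> C" using I(1) by simp
  qed
qed

section \<open>Ring structure on sums of an image and an ideal, and on direct products\<close>

lemma (in ring_hom_ring) sum_subring_is_subring:
  assumes "ideal J S"
  shows "subring (carrier (sum_subring R S h J)) S"
proof -
  interpret J: ideal J S by fact
  define H where "H = {h a \<oplus>\<^bsub>S\<^esub> j | a j. a \<in> carrier R \<and> j \<in> J}"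
  have H: "h a \<oplus>\<^bsub>S\<^esub> j \<in> H" if "a \<in> carrier R" "j \<in> J" for a j
    using that unfolding H_def by blast
  have "subring H S"
  proof (rule S.subringI)
    show "H \<subseteq> carrier S" unfolding H_def using J.Icarr by auto
    have "h \<one> \<oplus>\<^bsub>S\<^esub> \<zero>\<^bsub>S\<^esub> \<in> H" by (intro H J.zero_closed) simp
    then show "\<one>\<^bsub>S\<^esub> \<in> H" by simp
  next
    fix x assume "x \<in> H"
    then obtain a j where x: "a \<in> carrier R" "j \<in> J" "x = h a \<oplus>\<^bsub>S\<^esub> j" unfolding H_def by blast
    have j: "j \<in> carrier S" using x J.Icarr by auto
    have "h (\<ominus> a) \<oplus>\<^bsub>S\<^esub> (\<ominus>\<^bsub>S\<^esub> j) \<in> H" using x by (intro H J.a_inv_closed) simp_all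
    then show "\<ominus>\<^bsub>S\<^esub> x \<in> H" using x(1,3) j by (simp add: S.minus_add)
  next
    fix x y assume "x \<in> H" "y \<in> H"
    then obtain a j b k where x: "a \<in> carrier R" "j \<in> J" "x = h a \<oplus>\<^bsub>S\<^esub> j"
      and y: "b \<in> carrier R" "k \<in> J" "y = h b \<oplus>\<^bsub>S\<^esub> k" unfolding H_def by blast
    have jk: "j \<in> carrier S" "k \<in> carrier S" using x y J.Icarr by auto
    have "h (a \<oplus> b) \<oplus>\<^bsub>S\<^esub> (j \<oplus>\<^bsub>S\<^esub> k) \<in> H" using x y by (intro H J.a_closed) simp_all
    then show "x \<oplus>\<^bsub>S\<^esub> y \<in> H" using x(1,3) y(1,3) jk by (simp add: S.a_ac)
    \<comment> \<open>Expanding the product leaves \<open>h a * h b\<close> as the image part; the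
      other terms each contain a factor \<open>j\<close> or \<open>k\<close> and so form the part in
      \<open>J\<close>.\<close>
    have "h (a \<otimes> b) \<oplus>\<^bsub>S\<^esub> (h a \<otimes>\<^bsub>S\<^esub> k \<oplus>\<^bsub>S\<^esub> j \<otimes>\<^bsub>S\<^esub> (h b \<oplus>\<^bsub>S\<^esub> k)) \<in> H"
      using x y jk by (intro H J.a_closed J.I_l_closed J.I_r_closed) auto
    then show "x \<otimes>\<^bsub>S\<^esub> y \<in> H" using x(1,3) y(1,3) jk by (simp add: S.l_distr S.r_distr S.a_ac)
  qed
  then show ?thesis unfolding H_def sum_subring_def by simp
qed

lemma (in ring_hom_ring) sum_subring_is_ring:
  assumes "ideal J S"
  shows "ring (sum_subring R S h J)"
  using S.subring_is_ring[OF sum_subring_is_subring[OF assms]] unfolding sum_subring_def by simp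

lemma RDirProd_simps [simp]:
  "carrier (RDirProd R S) = carrier R \<times> carrier S"
  "x \<oplus>\<^bsub>RDirProd R S\<^esub> y = (fst x \<oplus>\<^bsub>R\<^esub> fst y, snd x \<oplus>\<^bsub>S\<^esub> snd y)"
  "x \<otimes>\<^bsub>RDirProd R S\<^esub> y = (fst x \<otimes>\<^bsub>R\<^esub> fst y, snd x \<otimes>\<^bsub>S\<^esub> snd y)"
  "\<zero>\<^bsub>RDirProd R S\<^esub> = (\<zero>\<^bsub>R\<^esub>, \<zero>\<^bsub>S\<^esub>)"
  "\<one>\<^bsub>RDirProd R S\<^esub> = (\<one>\<^bsub>R\<^esub>, \<one>\<^bsub>S\<^esub>)"
  by (auto simp: RDirProd_def DirProd_def monoid.defs split: prod.splits)

lemma ideal_RDirProd: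
  assumes I: "ideal I R" and J: "ideal J S"
  shows "ideal (I \<times> J) (RDirProd R S)"
proof (rule idealI)
  interpret I: ideal I R by fact
  interpret J: ideal J S by fact
  show "ring (RDirProd R S)" by (rule RDirProd_ring[OF I.ring_axioms J.ring_axioms])
  \<comment> \<open>The additive monoid of \<open>RDirProd\<close> is the direct product of the two
    additive monoids, so the statement about subgroups of direct products applies.\<close>
  show "subgroup (I \<times> J) (add_monoid (RDirProd R S))"
    using DirProd_subgroups[OF I.add.group_axioms I.a_subgroup J.add.group_axioms J.a_subgroup]
    by (simp only: RDirProd_add_monoid)
  fix a x assume "a \<in> I \<times> J" "x \<in> carrier (RDirProd R S)"
  then show "x \<otimes>\<^bsub>RDirProd R S\<^esub> a \<in> I \<times> J" "a \<otimes>\<^bsub>RDirProd R S\<^esub> x \<in> I \<times> J"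
    using I.I_l_closed I.I_r_closed J.I_l_closed J.I_r_closed by auto
qed

text \<open>This reduces the ring axioms for the bi-amalgamation to the general result on
  \<open>sum_subring\<close>, applied to the homomorphism into the product with components
  \<open>f\<close> and \<open>g\<close>.\<close>

lemma bi_amalgamation_eq_sum_subring:
  "bi_amalgamation A B C f g J J' = sum_subring A (RDirProd B C) (\<lambda>a. (f a, g a)) (J \<times> J')"
proof -
  have "{(f a \<oplus>\<^bsub>B\<^esub> j, g a \<oplus>\<^bsub>C\<^esub> j') | a j j'. a \<in> carrier A \<and> (j, j') \<in> J \<times> J'} =
    {(f a, g a) \<oplus>\<^bsub>RDirProd B C\<^esub> j | a j. a \<in> carrier A \<and> j \<in> J \<times> J'}"
    by force
  then show ?thesis unfolding bi_amalgamation_def sum_subring_def by simp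
qed

theorem proposition4p2:
  fixes A :: "('a, 'm) ring_scheme"
    and B :: "('b, 'n) ring_scheme"
    and C :: "('c, 'k) ring_scheme"
    and f :: "'a \<Rightarrow> 'b" and g :: "'a \<Rightarrow> 'c"
    and J :: "'b set" and J' :: "'c set"
  assumes "cring A" and "cring B" and "cring C"
    and "f \<in> ring_hom A B" and "g \<in> ring_hom A C"
    and "ideal J B" and "ideal J' C"
    and "{a \<in> carrier A. f a \<in> J} = {a \<in> carrier A. g a \<in> J'}"
  shows "noetherian_ring (bi_amalgamation A B C f g J J') \<longleftrightarrow>
    noetherian_ring (sum_subring A B f J) \<and> noetherian_ring (sum_subring A C g J')"
proof -
  interpret A: cring A by fact
  interpret B: cring B by fact
  interpret C: cring C by fact
  interpret J: ideal J B by fact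
  interpret J': ideal J' C by fact
  interpret f: ring_hom_ring A B f using assms(4) by unfold_locales
  interpret g: ring_hom_ring A C g using assms(5) by unfold_locales
  interpret fg: ring_hom_ring A "RDirProd B C" "\<lambda>a. (f a, g a)"
  proof (rule ring_hom_ringI2[OF A.ring_axioms RDirProd_ring[OF B.ring_axioms C.ring_axioms]])
    show "(\<lambda>a. (f a, g a)) \<in> ring_hom A (RDirProd B C)"
      by (rule ring_hom_memI) simp_all
  qed
  let ?D = "bi_amalgamation A B C f g J J'"
  let ?S = "sum_subring A B f J" and ?T = "sum_subring A C g J'"
  have D_ring: "ring ?D"
    unfolding bi_amalgamation_eq_sum_subring
    by (rule fg.sum_subring_is_ring[OF ideal_RDirProd[OF assms(6,7)]])
  have p: "ring_hom_ring ?D ?S fst"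
  proof (rule ring_hom_ringI2[OF D_ring f.sum_subring_is_ring[OF assms(6)]])
    show "fst \<in> ring_hom ?D ?S"
      by (rule ring_hom_memI) (force simp: bi_amalgamation_def sum_subring_def)+
  qed
  have q: "ring_hom_ring ?D ?T snd"
  proof (rule ring_hom_ringI2[OF D_ring g.sum_subring_is_ring[OF assms(7)]])
    show "snd \<in> ring_hom ?D ?T"
      by (rule ring_hom_memI) (force simp: bi_amalgamation_def sum_subring_def)+
  qed
  have D_memI: "(f a \<oplus>\<^bsub>B\<^esub> j, g a \<oplus>\<^bsub>C\<^esub> j') \<in> carrier ?D"
    if "a \<in> carrier A" "j \<in> J" "j' \<in> J'" for a j j'
    using that unfolding bi_amalgamation_def by auto
  have p_surj: "fst ` carrier ?D = carrier ?S"
  proof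
    show "fst ` carrier ?D \<subseteq> carrier ?S"
      using ring_hom_closed[OF ring_hom_ring.homh[OF p]] by blast
    \<comment> \<open>The element \<open>f a + j\<close> lifts to the pair
      \<open>(f a + j, g a + 0)\<close>.\<close>
    show "carrier ?S \<subseteq> fst ` carrier ?D"
      unfolding sum_subring_def
      by (auto intro!: image_eqI[OF _ D_memI[OF _ _ J'.zero_closed]])
  qed
  have q_surj: "snd ` carrier ?D = carrier ?T"
  proof
    show "snd ` carrier ?D \<subseteq> carrier ?T"
      using ring_hom_closed[OF ring_hom_ring.homh[OF q]] by blast
    show "carrier ?T \<subseteq> snd ` carrier ?D"
      unfolding sum_subring_def
      by (auto intro!: image_eqI[OF _ D_memI[OF _ J.zero_closed]])
  qed
  \<comment> \<open>Kernels contain only carrier elements, so membership of zero in the carrier is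
    needed for equality with the singleton. Conversely, a pair killed by both projections has both
    components zero.\<close>
  have "\<zero>\<^bsub>?D\<^esub> \<in> carrier ?D" by (rule ring.ring_simprules(2)[OF D_ring])
  then have "a_kernel ?D ?S fst \<inter> a_kernel ?D ?T snd = {\<zero>\<^bsub>?D\<^esub>}"
    unfolding a_kernel_def' by (auto simp: bi_amalgamation_def sum_subring_def)
  with noetherian_subdirect_product[OF p p_surj q q_surj]
    ring_hom_ring.noetherian_image[OF p p_surj] ring_hom_ring.noetherian_image[OF q q_surj]
  show ?thesis by blast
qed

end
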